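(* Let $A$ and $B$ be non-empty compact subsets of $\mathbb{R}$ with $|A| \ge |B|$, where $|\cdot|$ denotes Lebesgue measure. Then there are elements $b_1,b_2,b_3 \in B$ such that $$|A+\{b_1,b_2,b_3\}| \ge |A|+|B|.$$
   Context: For subsets $X,Y$ of $\mathbb{R}$, $X+Y=\{x+y : x\in X, y\in Y\}$. The elements $b_1,b_2,b_3$ are not required to be distinct. *)

theory Defs
  imports "HOL-Analysis.Analysis" "HOL-Library.Set_Algebras"
begin

end

theory Submission
  imports Defs
begin

text \<open>
  Take \<open>b1\<close> and \<open>b2\<close> to be the minimum and maximum of \<open>B\<close>, put \<open>m = b2 - b1\<close>, and let
  \<open>P = A + m\<int>\<close> and \<open>D = (A + m) - A\<close>. Every class modulo \<open>m\<close> that meets \<open>A\<close> also meets \<open>D\<close>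
  (step past the last point of \<open>A\<close> in the class), so \<open>P\<close> has measure at most \<open>|D|\<close> in every window
  of length \<open>m\<close>, whereas \<open>|A + {0, m}| = |A| + |D|\<close>. If \<open>|D| \<ge> |B|\<close>, two translates suffice.
  Otherwise, by Fubini, the average of \<open>|(A + b - b1) \<inter> P|\<close> over \<open>b \<in> B\<close> is at most
  \<open>|A| |D| / |B|\<close>, so for some \<open>b\<close> the part of \<open>A + b - b1\<close> outside \<open>P\<close>, hence outside
  \<open>A + {0, m}\<close>, has measure at least \<open>|A| (1 - |D| / |B|) \<ge> |B| - |D|\<close>.
\<close>

text \<open>If \<open>F b * emeasure M B\<close> exceeded \<open>c\<close> on all of
  \<open>B\<close>, integrating over \<open>B\<close> would make \<open>emeasure M B\<close> times
  the integral of \<open>F\<close> exceed \<open>c * emeasure M B\<close>, against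
  \<open>le\<close>. Multiplying by the measure of \<open>B\<close> avoids division in
  \<open>ennreal\<close>.\<close>

lemma exists_le_average:
  fixes F :: "'a \<Rightarrow> ennreal"
  assumes F[measurable]: "F \<in> borel_measurable M" and B[measurable]: "B \<in> sets M"
    and B0: "emeasure M B \<noteq> 0" and Binf: "emeasure M B \<noteq> \<infinity>"
    and le: "(\<integral>\<^sup>+b\<in>B. F b \<partial>M) \<le> c"
  shows "\<exists>b\<in>B. F b * emeasure M B \<le> c"
proof (rule ccontr)
  assume "\<not> ?thesis"
  then have gt: "c < F b * emeasure M B" if "b \<in> B" for b
    using that by force
  have "B \<noteq> {}"
    using B0 by auto
  \<comment> \<open>Strictness survives integration only when the smaller integral is finite;
    \<open>c\<close> is finite because it lies strictly below some value.\<close>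
  then have c: "c \<noteq> \<infinity>"
    using gt by force
  have int_c: "(\<integral>\<^sup>+b\<in>B. c \<partial>M) = c * emeasure M B"
    by (simp add: nn_integral_cmult_indicator)
  have "(\<integral>\<^sup>+b\<in>B. c \<partial>M) < (\<integral>\<^sup>+b\<in>B. (F b * emeasure M B) \<partial>M)"
  proof (rule nn_integral_less)
    show "(\<integral>\<^sup>+b\<in>B. c \<partial>M) \<noteq> \<infinity>"
      using c Binf by (simp add: int_c ennreal_mult_eq_top_iff)
    show "AE b in M. c * indicator B b \<le> F b * emeasure M B * indicator B b"
      using gt by (auto simp: indicator_def less_imp_le)
    show "\<not> (AE b in M. F b * emeasure M B * indicator B b \<le> c * indicator B b)"
    proof
      assume "AE b in M. F b * emeasure M B * indicator B b \<le> c * indicator B b"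
      then have "AE b in M. b \<notin> B"
        by eventually_elim (use gt in \<open>auto simp: indicator_def not_le[symmetric] split: if_splits\<close>)
      then have "emeasure M B = 0"
        using AE_iff_measurable[OF B, of "\<lambda>b. b \<notin> B"] sets.sets_into_space[OF B] by auto
      with B0 show False by simp
    qed
  qed auto
  also have "\<dots> = (\<integral>\<^sup>+b. emeasure M B * (F b * indicator B b) \<partial>M)"
    by (simp add: mult_ac)
  also have "\<dots> = emeasure M B * (\<integral>\<^sup>+b\<in>B. F b \<partial>M)"
    by (rule nn_integral_cmult) simp
  also have "\<dots> \<le> emeasure M B * c"
    using le by (rule mult_left_mono) simp
  finally show False
    by (simp add: int_c mult.commute)
qed

lemma emeasure_lborel_vimage_add:
  fixes S :: "real set"
  assumes "S \<in> sets borel"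
  shows "emeasure lborel {x. x + c \<in> S} = emeasure lborel S"
proof -
  have "emeasure lborel S = emeasure (distr lborel borel ((+) c)) S"
    by (simp add: lborel_distr_plus)
  also have "\<dots> = emeasure lborel {x. x + c \<in> S}"
    using assms by (subst emeasure_distr) (auto simp: vimage_def add.commute)
  finally show ?thesis by simp
qed

text \<open>Cut \<open>S\<close> along the windows \<open>[c + k m, c + (k + 1) m)\<close> and
  translate each piece back to the base window. The pieces \<open>S \<inter> I n\<close> are
  disjoint, and their translates \<open>T n\<close> cover the left-hand set, possibly with overlap.
  \<open>int_decode\<close> lists the integers as a sequence, as countable additivity
  requires.\<close>

lemma emeasure_periodization_le:
  fixes S :: "real set" and c m :: real
  assumes S[measurable]: "S \<in> sets borel" and m: "m > 0"
  shows "emeasure lborel {x \<in> {c..<c + m}. \<exists>k::int. x + of_int k * m \<in> S} \<le> emeasure lborel S"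
proof -
  define I where "I n = {c + of_int (int_decode n) * m..<c + of_int (int_decode n) * m + m}" for n
  define T where "T n = {x. x + of_int (int_decode n) * m \<in> S \<inter> I n}" for n
  have I[measurable]: "I n \<in> sets borel" for n
    by (simp add: I_def)
  have T: "emeasure lborel (T n) = emeasure lborel (S \<inter> I n)" for n
    unfolding T_def by (rule emeasure_lborel_vimage_add) simp
  have T_meas[measurable]: "T n \<in> sets borel" for n
    unfolding T_def by measurable
  have disj: "disjoint_family (\<lambda>n. S \<inter> I n)"
  proof -
    have "n = n'" if "x \<in> S \<inter> I n" "x \<in> S \<inter> I n'" for n n' x
    proof -
      \<comment> \<open>Each half-open window containing \<open>x\<close> starts before the other
        ends, so the two integer indices differ by less than 1.\<close>
      have "of_int (int_decode n) * m < (of_int (int_decode n' + 1) :: real) * m"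
        "of_int (int_decode n') * m < (of_int (int_decode n + 1) :: real) * m"
        using that by (auto simp: I_def algebra_simps)
      then have "int_decode n = int_decode n'"
        using m by (simp only: mult_less_cancel_right_pos of_int_less_iff)
      then show ?thesis
        by (metis int_decode_inverse)
    qed
    then show ?thesis
      by (auto simp: disjoint_family_on_def)
  qed
  have "{x \<in> {c..<c + m}. \<exists>k::int. x + of_int k * m \<in> S} \<subseteq> (\<Union>n. T n)"
  proof clarsimp
    fix x :: real and k :: int
    assume "x + of_int k * m \<in> S" "c \<le> x" "x < c + m"
    then have "x \<in> T (int_encode k)"
      by (simp add: T_def I_def)
    then show "\<exists>n. x \<in> T n" ..
  qed
  then have "emeasure lborel {x \<in> {c..<c + m}. \<exists>k::int. x + of_int k * m \<in> S}
      \<le> emeasure lborel (\<Union>n. T n)"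
    by (intro emeasure_mono) auto
  also have "\<dots> \<le> (\<Sum>n. emeasure lborel (T n))"
    by (rule emeasure_subadditive_countably) auto
  also have "\<dots> = (\<Sum>n. emeasure lborel (S \<inter> I n))"
    by (simp add: T)
  also have "\<dots> = emeasure lborel (\<Union>n. S \<inter> I n)"
    using disj by (intro suminf_emeasure) auto
  also have "\<dots> \<le> emeasure lborel S"
    by (intro emeasure_mono) auto
  finally show ?thesis .
qed

text \<open>Otherwise membership in \<open>A\<close> would propagate from \<open>x + k m\<close>
  upwards in steps of \<open>m\<close> and pass any upper bound of \<open>A\<close>.\<close>

lemma ex_last_translate:
  fixes A :: "real set" and m x :: real and k :: int
  assumes "bounded A" and m: "m > 0" and k: "x + of_int k * m \<in> A"
  shows "\<exists>j::int. x + of_int j * m \<in> A \<and> x + of_int (j + 1) * m \<notin> A"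
proof (rule ccontr)
  assume "\<not> ?thesis"
  then have step: "x + of_int (j + 1) * m \<in> A" if "x + of_int j * m \<in> A" for j :: int
    using that by blast
  have all: "x + of_int (k + int n) * m \<in> A" for n
  proof (induction n)
    case (Suc n)
    from step[OF this] show ?case
      by (simp add: algebra_simps)
  qed (use k in simp)
  obtain r where r: "\<And>y. y \<in> A \<Longrightarrow> y \<le> r"
    using bounded_imp_bdd_above[OF \<open>bounded A\<close>] by (auto simp: bdd_above_def)
  obtain n :: nat where "(r - (x + of_int k * m)) / m < n"
    using reals_Archimedean2 by blast
  then have "r < x + of_int (k + int n) * m"
    using m by (simp add: field_simps)
  with r[OF all[of n]] show False
    by simp
qed

text \<open>The left side is the planar measure of the pairs \<open>(y, b)\<close> in
  \<open>A \<times> B\<close> with \<open>y + b \<in> P\<close>. Slicing along \<open>y\<close>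
  instead of \<open>b\<close> makes every slice at most \<open>d\<close>.\<close>

lemma nn_integral_translate_le:
  fixes A B P :: "real set"
  assumes [measurable]: "A \<in> sets borel" "B \<in> sets borel" "P \<in> sets borel"
    and le: "\<And>y. emeasure lborel {b \<in> B. y + b \<in> P} \<le> d"
  shows "(\<integral>\<^sup>+b\<in>B. emeasure lborel {y \<in> A. y + b \<in> P} \<partial>lborel) \<le> d * emeasure lborel A"
proof -
  have "(\<integral>\<^sup>+b\<in>B. emeasure lborel {y \<in> A. y + b \<in> P} \<partial>lborel) =
      (\<integral>\<^sup>+b. (\<integral>\<^sup>+y. indicator B b * indicator A y * indicator P (y + b) \<partial>lborel) \<partial>lborel)"
  proof (rule nn_integral_cong)
    fix b :: real
    have "emeasure lborel {y \<in> A. y + b \<in> P} * indicator B b =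
        (\<integral>\<^sup>+y. indicator B b * indicator {y \<in> A. y + b \<in> P} y \<partial>lborel)"
      by (subst nn_integral_cmult_indicator) (auto simp: mult.commute)
    also have "\<dots> = (\<integral>\<^sup>+y. indicator B b * indicator A y * indicator P (y + b) \<partial>lborel)"
      by (intro nn_integral_cong) (auto simp: indicator_def)
    finally show "emeasure lborel {y \<in> A. y + b \<in> P} * indicator B b = \<dots>" .
  qed
  also have "\<dots> = (\<integral>\<^sup>+y. (\<integral>\<^sup>+b. indicator B b * indicator A y * indicator P (y + b) \<partial>lborel) \<partial>lborel)"
    by (rule lborel_pair.Fubini') measurable
  also have "\<dots> = (\<integral>\<^sup>+y. emeasure lborel {b \<in> B. y + b \<in> P} * indicator A y \<partial>lborel)"
  proof (rule nn_integral_cong)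
    fix y :: real
    have "(\<integral>\<^sup>+b. indicator B b * indicator A y * indicator P (y + b) \<partial>lborel) =
        (\<integral>\<^sup>+b. indicator A y * indicator {b \<in> B. y + b \<in> P} b \<partial>lborel)"
      by (intro nn_integral_cong) (auto simp: indicator_def)
    also have "\<dots> = emeasure lborel {b \<in> B. y + b \<in> P} * indicator A y"
      by (subst nn_integral_cmult_indicator) (auto simp: mult.commute)
    finally show "(\<integral>\<^sup>+b. indicator B b * indicator A y * indicator P (y + b) \<partial>lborel) = \<dots>" .
  qed
  also have "\<dots> \<le> (\<integral>\<^sup>+y. d * indicator A y \<partial>lborel)"
    by (intro nn_integral_mono mult_right_mono le) simp
  also have "\<dots> = d * emeasure lborel A"
    by (simp add: nn_integral_cmult_indicator)
  finally show ?thesis .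
qed

theorem corollary10:
  fixes A B :: "real set"
  assumes "compact A" and "A \<noteq> {}"
    and "compact B" and "B \<noteq> {}"
    and "measure lebesgue A \<ge> measure lebesgue B"
  shows "\<exists>b1\<in>B. \<exists>b2\<in>B. \<exists>b3\<in>B.
    measure lebesgue (A + {b1, b2, b3}) \<ge> measure lebesgue A + measure lebesgue B"
proof -

  \<comment> \<open>Normalization and auxiliary sets\<close>
  define \<mu> where "\<mu> = measure (lborel :: real measure)"
  have A[measurable]: "A \<in> sets borel" and B[measurable]: "B \<in> sets borel"
    using assms borel_compact by auto
  have fm: "S \<in> fmeasurable lborel" if "compact S" for S :: "real set"
    using that by (simp add: fmeasurable_compact)
  have \<mu>_shift: "\<mu> {x. x + c \<in> S} = \<mu> S" if "S \<in> sets borel" for S c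
    using emeasure_lborel_vimage_add[OF that] by (simp add: \<mu>_def measure_def)
  \<comment> \<open>The argument runs in \<open>lborel\<close>, where Fubini and the measurability
    of translates are at hand; this fact carries the result back to \<open>lebesgue\<close>.\<close>
  have leb: "measure lebesgue S = \<mu> S" if "S \<in> sets borel" for S
    using that by (simp add: \<mu>_def)
  have BA: "\<mu> B \<le> \<mu> A"
    using assms(5) by (simp add: \<mu>_def)
  obtain b1 where b1: "b1 \<in> B" "\<And>b. b \<in> B \<Longrightarrow> b1 \<le> b"
    using compact_attains_inf[OF assms(3,4)] by blast
  obtain b2 where b2: "b2 \<in> B" "\<And>b. b \<in> B \<Longrightarrow> b \<le> b2"
    using compact_attains_sup[OF assms(3,4)] by blast
  define m where "m = b2 - b1"
  define P where "P = {x. \<exists>k::int. x + of_int k * m \<in> A}"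
  define D where "D = {x. x - m \<in> A \<and> x \<notin> A}"
  \<comment> \<open>Everything is shifted by \<open>-b1\<close>, so that \<open>b1\<close>
    contributes \<open>A\<close> itself. Removing all of \<open>P\<close>, not just
    \<open>A \<union> D\<close>, makes the overlap with the translate periodic and so easy to
    average.\<close>
  define R where "R b = {x. x - (b - b1) \<in> A \<and> x \<notin> P}" for b
  have P[measurable]: "P \<in> sets borel" and D[measurable]: "D \<in> sets borel"
    unfolding P_def D_def by measurable
  have R[measurable]: "R b \<in> sets borel" for b
    unfolding R_def by measurable
  have AP: "A \<subseteq> P" "D \<subseteq> P"
  proof -
    have "x \<in> P" if "x + of_int k * m \<in> A" for x and k :: int
      using that by (auto simp: P_def)
    from this[of _ 0] this[of _ "-1"] show "A \<subseteq> P" "D \<subseteq> P"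
      by (auto simp: D_def)
  qed
  have compact_sum: "compact (A + {b1, b2, b})" for b
  proof -
    have "A + {b1, b2, b} = {x + y | x y. x \<in> A \<and> y \<in> {b1, b2, b}}"
      by (auto simp: set_plus_def)
    then show ?thesis
      using compact_sums[OF assms(1), of "{b1, b2, b}"] by (simp add: finite_imp_compact)
  qed
  have D_fin: "D \<in> fmeasurable lborel"
  proof (rule fmeasurableI2)
    show "{x. x - m \<in> A} \<in> fmeasurable lborel"
      using emeasure_lborel_vimage_add[OF A, of "-m"] fm[OF assms(1)]
      by (simp add: fmeasurable_def)
  qed (auto simp: D_def)

  \<comment> \<open>Lower bound for the sumset\<close>
  have bound: "\<mu> A + \<mu> D + \<mu> (R b) \<le> \<mu> (A + {b1, b2, b})" for b
  proof -
    define S where "S = A + {b1, b2, b}"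
    have cS: "compact S"
      unfolding S_def by (rule compact_sum)
    then have S: "S \<in> sets borel"
      by (rule borel_compact)
    have "{x. x + b1 \<in> S} = (\<lambda>x. x - b1) ` S"
      by (auto simp: image_iff) (metis add_diff_cancel_right')
    then have cS': "compact {x. x + b1 \<in> S}"
      using compact_translation_subtract[OF cS, of b1] by simp
    \<comment> \<open>The three sets come from the translates by \<open>b1\<close>,
      \<open>b2\<close> and \<open>b\<close> respectively.\<close>
    have sub: "A \<union> D \<union> R b \<subseteq> {x. x + b1 \<in> S}"
      by (auto simp: S_def D_def R_def m_def set_plus_def)
         (metis add.commute add_diff_cancel_left' diff_add_cancel add_diff_eq diff_diff_eq2)+
    have f: "A \<union> D \<union> R b \<in> fmeasurable lborel"
      using fm[OF cS'] sub by (rule fmeasurableI2) simp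
    have f': "A \<in> fmeasurable lborel" "D \<in> fmeasurable lborel" "R b \<in> fmeasurable lborel"
      by (rule fmeasurableI2[OF f]; auto)+
    \<comment> \<open>The union is disjoint: \<open>D\<close> avoids \<open>A\<close>, and
      \<open>R b\<close> avoids \<open>P\<close>, which contains both.\<close>
    have "\<mu> A + \<mu> D + \<mu> (R b) = \<mu> (A \<union> D \<union> R b)"
    proof -
      have "\<mu> (A \<union> D) = \<mu> A + \<mu> D"
        using f' unfolding \<mu>_def by (intro measure_Un_AE) (auto simp: D_def)
      moreover have "\<mu> (A \<union> D \<union> R b) = \<mu> (A \<union> D) + \<mu> (R b)"
        using f' AP unfolding \<mu>_def by (intro measure_Un_AE) (auto simp: R_def)
      ultimately show ?thesis by simp
    qed
    also have "\<dots> \<le> \<mu> {x. x + b1 \<in> S}"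
      unfolding \<mu>_def using sub fm[OF cS'] by (intro measure_mono_fmeasurable) auto
    also have "\<dots> = \<mu> S"
      using S by (rule \<mu>_shift)
    finally show ?thesis
      by (simp add: S_def)
  qed

  \<comment> \<open>Choice of the third translate\<close>
  have "\<exists>b3\<in>B. \<mu> B \<le> \<mu> D + \<mu> (R b3)"
  proof (cases "\<mu> B \<le> \<mu> D")
    case True
    have "0 \<le> \<mu> (R b1)"
      by (simp add: \<mu>_def)
    with True b1(1) show ?thesis
      by (intro bexI[of _ b1]) auto
  next
    case False
    then have DB: "\<mu> D < \<mu> B"
      by simp
    moreover have "0 \<le> \<mu> D"
      by (simp add: \<mu>_def)
    ultimately have pos: "\<mu> B > 0"
      by simp
    have "m \<noteq> 0"
    proof
      assume "m = 0"
      then have "B = {b1}"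
        using b1 b2 by (force simp: m_def)
      then show False
        using pos by (simp add: \<mu>_def)
    qed
    then have m: "m > 0"
      using b1(2)[OF b2(1)] by (simp add: m_def)
    \<comment> \<open>The wasted part of the translate, pulled back into \<open>A\<close>: its
      points land in \<open>P\<close> and add nothing to \<open>R b\<close>.\<close>
    define F where "F b = {y \<in> A. y + (b - b1) \<in> P}" for b
    have F[measurable]: "F b \<in> sets borel" for b
      unfolding F_def by measurable
    have F_meas: "(\<lambda>b. emeasure lborel (F b)) \<in> borel_measurable lborel"
    proof -
      have "{p \<in> space (lborel \<Otimes>\<^sub>M lborel). snd p \<in> F (fst p)} \<in> sets (lborel \<Otimes>\<^sub>M lborel)"
        unfolding F_def by measurable
      from lborel.measurable_emeasure_Pair[OF this] show ?thesis
        by (simp add: vimage_def space_pair_measure)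
    qed
    have PD: "P \<subseteq> {x. \<exists>k::int. x + of_int k * m \<in> D}"
    proof
      fix x assume "x \<in> P"
      then obtain k :: int where "x + of_int k * m \<in> A"
        by (auto simp: P_def)
      from ex_last_translate[OF compact_imp_bounded[OF assms(1)] m this]
      obtain j :: int where "x + of_int j * m \<in> A" "x + of_int (j + 1) * m \<notin> A"
        by blast
      then have "x + of_int (j + 1) * m \<in> D"
        by (simp add: D_def algebra_simps)
      then show "x \<in> {x. \<exists>k::int. x + of_int k * m \<in> D}"
        by blast
    qed
    have window: "emeasure lborel {b \<in> B. y + (b - b1) \<in> P} \<le> emeasure lborel D" for y
    proof -
      define W where "W = {x \<in> {y..<y + m}. \<exists>k::int. x + of_int k * m \<in> D}"
      have W[measurable]: "W \<in> sets borel"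
        unfolding W_def by measurable
      \<comment> \<open>\<open>B\<close> lies in the closed interval from \<open>b1\<close> to
        \<open>b2\<close>, of length \<open>m\<close>, while the window is half-open; the endpoint
        \<open>b2\<close> is split off as a null set.\<close>
      have "{b \<in> B. y + (b - b1) \<in> P} \<subseteq> {b2} \<union> {b. b + (y - b1) \<in> W}"
      proof
        fix b assume b: "b \<in> {b \<in> B. y + (b - b1) \<in> P}"
        then have "b + (y - b1) \<in> P"
          by (simp add: algebra_simps)
        then have "\<exists>k::int. b + (y - b1) + of_int k * m \<in> D"
          using PD by blast
        moreover have "y \<le> b + (y - b1)" "b \<noteq> b2 \<Longrightarrow> b + (y - b1) < y + m"
          using b b1(2)[of b] b2(2)[of b] by (auto simp: m_def)
        ultimately show "b \<in> {b2} \<union> {b. b + (y - b1) \<in> W}"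
          unfolding W_def by auto
      qed
      then have "emeasure lborel {b \<in> B. y + (b - b1) \<in> P}
          \<le> emeasure lborel ({b2} \<union> {b. b + (y - b1) \<in> W})"
        by (intro emeasure_mono) auto
      also have "\<dots> \<le> emeasure lborel {b2} + emeasure lborel {b. b + (y - b1) \<in> W}"
        by (intro emeasure_subadditive) auto
      also have "\<dots> = emeasure lborel W"
        by (simp add: emeasure_lborel_vimage_add)
      also have "\<dots> \<le> emeasure lborel D"
        unfolding W_def using m by (intro emeasure_periodization_le) auto
      finally show ?thesis .
    qed
    have B_pos: "emeasure lborel B \<noteq> 0" and B_fin: "emeasure lborel B \<noteq> \<infinity>"
      using pos fm[OF assms(3)] by (auto simp: \<mu>_def measure_def fmeasurable_def)
    \<comment> \<open>The shift by \<open>b1\<close> is absorbed into the target set, so that the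
      condition takes the form \<open>y + b\<close> in a fixed set.\<close>
    have "(\<integral>\<^sup>+b\<in>B. emeasure lborel (F b) \<partial>lborel) \<le> emeasure lborel D * emeasure lborel A"
      using nn_integral_translate_le[of A B "{x. x - b1 \<in> P}" "emeasure lborel D"] window
      by (simp add: F_def add_diff_eq)
    then obtain b3 where b3: "b3 \<in> B"
      and le: "emeasure lborel (F b3) * emeasure lborel B \<le> emeasure lborel D * emeasure lborel A"
      using exists_le_average[OF F_meas _ B_pos B_fin] by auto
    have F_fin: "F b \<in> fmeasurable lborel" for b
      using fm[OF assms(1)] by (rule fmeasurableI2) (auto simp: F_def)
    have le': "\<mu> (F b3) * \<mu> B \<le> \<mu> D * \<mu> A"
      using le F_fin[of b3] D_fin fm[OF assms(1)] fm[OF assms(3)]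
      by (simp add: emeasure_eq_measure2 \<mu>_def flip: ennreal_mult)
    \<comment> \<open>Translated back, \<open>R b3\<close> is exactly the complement of
      \<open>F b3\<close> in \<open>A\<close>.\<close>
    have "\<mu> (R b3) = \<mu> {x. x + (b3 - b1) \<in> R b3}"
      by (rule \<mu>_shift[symmetric]) simp
    also have "{x. x + (b3 - b1) \<in> R b3} = A - F b3"
      by (auto simp: R_def F_def)
    also have "\<mu> (A - F b3) = \<mu> A - \<mu> (F b3)"
      unfolding \<mu>_def using fm[OF assms(1)] by (intro measure_Diff) (auto simp: F_def fmeasurable_def)
    finally have R_eq: "\<mu> (R b3) = \<mu> A - \<mu> (F b3)" .
    \<comment> \<open>Here the hypothesis |A| \<ge> |B| enters. By \<open>le'\<close>, the right
      side is at most \<open>\<mu> B * (\<mu> A - \<mu> (F b3))\<close>, and \<open>\<mu> B\<close>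
      then cancels.\<close>
    have "\<mu> B * (\<mu> B - \<mu> D) \<le> \<mu> A * (\<mu> B - \<mu> D)"
      using BA DB by (intro mult_right_mono) auto
    with le' have "\<mu> B * (\<mu> B - \<mu> D) \<le> \<mu> B * \<mu> (R b3)"
      by (simp add: R_eq algebra_simps)
    then have "\<mu> B - \<mu> D \<le> \<mu> (R b3)"
      using pos by simp
    with b3 show ?thesis
      by (intro bexI[of _ b3]) auto
  qed
  then obtain b3 where b3: "b3 \<in> B" and *: "\<mu> B \<le> \<mu> D + \<mu> (R b3)"
    by blast
  have "A + {b1, b2, b3} \<in> sets borel"
    using compact_sum by (rule borel_compact)
  then have "measure lebesgue A + measure lebesgue B \<le> measure lebesgue (A + {b1, b2, b3})"
    using bound[of b3] * by (simp only: leb[OF A] leb[OF B] leb)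
  with b1(1) b2(1) b3 show ?thesis
    by blast
qed

end
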